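(* Let $R\in\mathbb R^{2\times2}$ be symmetric, $\mathbf r\in\mathbb R^2$, $p\in\mathbb R$. The polynomial $f_{R,\mathbf r,p}$ is nonnegative on the half-strip $[0,1]\times[0,\infty)$ (i.e. $f_{R,\mathbf r,p}(z_1,z_2)\ge0$ for all $z_1\in[0,1]$, $z_2\ge0$) if and only if there exist $t_1,\dots,t_{19}\in\mathbb R$ such that $\Lambda_1,\dots,\Lambda_6\succeq0$ and the following polynomial identity in $(z_1,z_2)$ holds: $$\begin{aligned} f_{R,\mathbf r,p}(z_1,z_2)=&\begin{pmatrix} z_2 \\ z_2^2 \\ z_1 \end{pmatrix}^{\top}\Lambda_1\begin{pmatrix} z_2 \\ z_2^2 \\ z_1 \end{pmatrix}+z_2\begin{pmatrix} z_2 \\ z_1 \end{pmatrix}^{\top}\Lambda_2\begin{pmatrix} z_2 \\ z_1 \end{pmatrix}+z_1z_2(1-z_1)\begin{pmatrix} 0 \\ 1 \end{pmatrix}^{\top}\Lambda_2\begin{pmatrix} 0 \\ 1 \end{pmatrix} \\ &+z_1z_2\begin{pmatrix} 1 \\ z_2 \end{pmatrix}^{\top}\Lambda_3\begin{pmatrix} 1 \\ z_2 \end{pmatrix}+z_1\begin{pmatrix} z_2^2 \\ z_2 \\ 0 \end{pmatrix}^{\top}\Lambda_4\begin{pmatrix} z_2^2 \\ z_2 \\ 0 \end{pmatrix}+(1-z_1)\begin{pmatrix} z_2^2 \\ 0 \\ z_2 \end{pmatrix}^{\top}\Lambda_4\begin{pmatrix} z_2^2 \\ 0 \\ z_2 \end{pmatrix}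 \\ &+z_2\begin{pmatrix} z_2 \\ z_1 \end{pmatrix}^{\top}\Lambda_5\begin{pmatrix} z_2 \\ z_1 \end{pmatrix}+z_1\begin{pmatrix} z_1 \\ z_2 \\ 0 \end{pmatrix}^{\top}\Lambda_6\begin{pmatrix} z_1 \\ z_2 \\ 0 \end{pmatrix}+(1-z_1)\begin{pmatrix} z_1 \\ 0 \\ z_2 \end{pmatrix}^{\top}\Lambda_6\begin{pmatrix} z_1 \\ 0 \\ z_2 \end{pmatrix}.\end{aligned}$$
   Context: For symmetric $R\in\mathbb R^{2\times 2}$, $\mathbf r=(r_1,r_2)\in\mathbb R^2$, $p\in\mathbb R$, define the polynomial $$f_{R,\mathbf r,p}(z_1,z_2):=R_{11}z_2^4+2r_1z_2^3+pz_2^2+2R_{12}z_1z_2^2+2r_2z_1z_2+R_{22}z_1^2.$$ $M\succeq0$ means that the symmetric matrix $M$ is positive semidefinite. Given $(R,\mathbf r,p)$ and $t_1,\dots,t_{19}\in\mathbb R$, define the symmetric matrices $\Lambda_1,\dots,\Lambda_6$ as follows. $\Lambda_1$ is the symmetric $3\times3$ matrix $$\Lambda_1:=\begin{pmatrix} p-t_{11}-t_{19} & a & b \\ a & R_{11}-t_6 & c \\ b & c & R_{22}-t_{14} \end{pmatrix},$$ with $a:=r_1-\tfrac{t_1}{2}-t_8-\tfrac{t_{12}}{2}$, $b:=r_2-\tfrac{t_3}{2}-\tfrac{t_4}{2}-t_{16}$, $c:=R_{12}-t_2-t_5-t_{13}-\tfrac12(t_9-t_{11}+t_{17}-t_{19})$,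 and $$\Lambda_2:=\begin{pmatrix} t_1 & t_2 \\ t_2 & t_3 \end{pmatrix},\quad \Lambda_3:=\begin{pmatrix} t_4 & t_5 \\ t_5 & 2(t_8-t_7) \end{pmatrix},\quad \Lambda_4:=\begin{pmatrix} t_6 & t_7 & t_8 \\ t_7 & t_9 & t_{10} \\ t_8 & t_{10} & t_{11} \end{pmatrix},$$ $$\Lambda_5:=\begin{pmatrix} t_{12} & t_{13} \\ t_{13} & 2(t_{16}-t_{15}) \end{pmatrix},\quad \Lambda_6:=\begin{pmatrix} t_{14} & t_{15} & t_{16} \\ t_{15} & t_{17} & t_{18} \\ t_{16} & t_{18} & t_{19} \end{pmatrix}.$$ *)

theory Defs
  imports "HOL-Analysis.Analysis"
begin

definition qform :: "real^'n^'n \<Rightarrow> real^'n \<Rightarrow> real" where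
  "qform M v = v \<bullet> (M *v v)"

definition pos_semidef :: "real^'n^'n \<Rightarrow> bool" where
  "pos_semidef M \<longleftrightarrow> transpose M = M \<and> (\<forall>v. qform M v \<ge> 0)"

definition f_poly :: "real^2^2 \<Rightarrow> real^2 \<Rightarrow> real \<Rightarrow> real \<Rightarrow> real \<Rightarrow> real" where
  "f_poly R r p z1 z2 =
     R$1$1 * z2^4 + 2 * r$1 * z2^3 + p * z2^2
     + 2 * R$1$2 * z1 * z2^2 + 2 * r$2 * z1 * z2 + R$2$2 * z1^2"

text \<open>The parameters \<open>t\<^sub>1, \<dots>, t\<^sub>1\<^sub>9\<close> are the values \<open>t 1, \<dots>, t 19\<close> of a function on \<open>nat\<close>;
  its other values occur nowhere.\<close>

definition Lam1 :: "real^2^2 \<Rightarrow> real^2 \<Rightarrow> real \<Rightarrow> (nat \<Rightarrow> real) \<Rightarrow> real^3^3" where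
  "Lam1 R r p t =
     (let a = r$1 - t 1 / 2 - t 8 - t 12 / 2;
          b = r$2 - t 3 / 2 - t 4 / 2 - t 16;
          c = R$1$2 - t 2 - t 5 - t 13 - (1/2) * (t 9 - t 11 + t 17 - t 19)
      in vector [vector [p - t 11 - t 19, a, b],
                 vector [a, R$1$1 - t 6, c],
                 vector [b, c, R$2$2 - t 14]])"

definition Lam2 :: "(nat \<Rightarrow> real) \<Rightarrow> real^2^2" where
  "Lam2 t = vector [vector [t 1, t 2], vector [t 2, t 3]]"

definition Lam3 :: "(nat \<Rightarrow> real) \<Rightarrow> real^2^2" where
  "Lam3 t = vector [vector [t 4, t 5], vector [t 5, 2 * (t 8 - t 7)]]"

definition Lam4 :: "(nat \<Rightarrow> real) \<Rightarrow> real^3^3" where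
  "Lam4 t = vector [vector [t 6, t 7, t 8], vector [t 7, t 9, t 10], vector [t 8, t 10, t 11]]"

definition Lam5 :: "(nat \<Rightarrow> real) \<Rightarrow> real^2^2" where
  "Lam5 t = vector [vector [t 12, t 13], vector [t 13, 2 * (t 16 - t 15)]]"

definition Lam6 :: "(nat \<Rightarrow> real) \<Rightarrow> real^3^3" where
  "Lam6 t = vector [vector [t 14, t 15, t 16], vector [t 15, t 17, t 18], vector [t 16, t 18, t 19]]"

end

theory Submission
  imports Defs
begin

text \<open>
  The polynomial identity holds for every choice of \<open>t\<close>, so a certificate is just a solution of the six
  semidefinite constraints, and sufficiency is immediate. For necessity put \<open>y = z2\<close> and \<open>u = z1 / z2\<close>:
  then \<open>f / z2\<^sup>2\<close> is the quadratic \<open>p + 2 r1 y + 2 r2 u + A y\<^sup>2 + 2 B y u + C u\<^sup>2\<close>, to be considered on the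
  region \<open>y, u \<ge> 0\<close>, \<open>y u \<le> 1\<close>, and exchanging \<open>y\<close> with \<open>u\<close> exchanges \<open>\<Lambda>\<^sub>3, \<Lambda>\<^sub>4\<close> with \<open>\<Lambda>\<^sub>5, \<Lambda>\<^sub>6\<close>. The
  certifiable coefficient vectors form a closed convex cone, so a vector outside it is separated from it by
  a functional with moments \<open>(1, y, u, yy, w, uu)\<close>, where \<open>w\<close> stands for the moment of \<open>y u\<close>. Testing
  this functional on a few explicit members of the cone yields enough inequalities to show that it is
  nonnegative on every quadratic that is nonnegative on the region: such a quadratic only has to be
  examined along one line through the mean.
\<close>

subsection \<open>Positive semidefinite matrices of size two and three\<close>

text \<open>Scalar form of \<open>pos_semidef\<close>; the arguments list the upper triangle row by
  row, also in \<open>psd3\<close>.\<close>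

definition psd2 :: "real \<Rightarrow> real \<Rightarrow> real \<Rightarrow> bool" where
  "psd2 a b c \<longleftrightarrow> (\<forall>x y. 0 \<le> a * x^2 + 2 * b * x * y + c * y^2)"

definition psd3 :: "real \<Rightarrow> real \<Rightarrow> real \<Rightarrow> real \<Rightarrow> real \<Rightarrow> real \<Rightarrow> bool" where
  "psd3 a b c d e f \<longleftrightarrow> (\<forall>x y z. 0 \<le>
     a * x^2 + d * y^2 + f * z^2 + 2 * b * x * y + 2 * c * x * z + 2 * e * y * z)"

lemma vec2_eq: "(v::real^2) = vector [v$1, v$2]"
  by (simp add: vec_eq_iff forall_2)

lemma vec3_eq: "(v::real^3) = vector [v$1, v$2, v$3]"
  by (simp add: vec_eq_iff forall_3)

lemma qform_vector2:
  "qform (vector [vector [a, b], vector [b, c]] :: real^2^2) (vector [x, y])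
    = a * x^2 + 2 * b * x * y + c * y^2"
  by (simp add: qform_def inner_vec_def matrix_vector_mult_def sum_2 power2_eq_square algebra_simps)

lemma qform_vector3:
  "qform (vector [vector [a, b, c], vector [b, d, e], vector [c, e, f]] :: real^3^3) (vector [x, y, z])
    = a * x^2 + d * y^2 + f * z^2 + 2 * b * x * y + 2 * c * x * z + 2 * e * y * z"
  by (simp add: qform_def inner_vec_def matrix_vector_mult_def sum_3 power2_eq_square algebra_simps)

lemma pos_semidef_vector2:
  "pos_semidef (vector [vector [a, b], vector [b, c]] :: real^2^2) \<longleftrightarrow> psd2 a b c"
proof -
  have "transpose (vector [vector [a, b], vector [b, c]] :: real^2^2)
    = vector [vector [a, b], vector [b, c]]"
    by (simp add: vec_eq_iff forall_2 transpose_def)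
  then show ?thesis
    unfolding pos_semidef_def psd2_def by (metis qform_vector2 vec2_eq)
qed

lemma pos_semidef_vector3:
  "pos_semidef (vector [vector [a, b, c], vector [b, d, e], vector [c, e, f]] :: real^3^3)
    \<longleftrightarrow> psd3 a b c d e f"
proof -
  have "transpose (vector [vector [a, b, c], vector [b, d, e], vector [c, e, f]] :: real^3^3)
    = vector [vector [a, b, c], vector [b, d, e], vector [c, e, f]]"
    by (simp add: vec_eq_iff forall_3 transpose_def)
  then show ?thesis
    unfolding pos_semidef_def psd3_def by (metis qform_vector3 vec3_eq)
qed

subsection \<open>Moments of quadratics nonnegative on the hyperbolic region\<close>

definition quad :: "real \<Rightarrow> real \<Rightarrow> real \<Rightarrow> real \<Rightarrow> real \<Rightarrow> real \<Rightarrow> real \<Rightarrow> real \<Rightarrow> real" where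
  "quad p r1 r2 A B C y u = p + 2 * r1 * y + 2 * r2 * u + A * y^2 + 2 * B * y * u + C * u^2"

text \<open>On the line of slope \<open>a\<close> the form minus its chord over
  \<open>[s1, s2]\<close> is \<open>G (s - s1) (s - s2)\<close> with
  \<open>G = A + 2 B a + C a^2\<close>; the bounded quantity is the chord's value at
  \<open>s = 0\<close>.\<close>

lemma quad_chord:
  assumes "s1 \<le> 0" "0 \<le> s2" "s1 < s2"
    and "0 \<le> quad p r1 r2 A B C (y + s1) (u + a * s1)"
    and "0 \<le> quad p r1 r2 A B C (y + s2) (u + a * s2)"
  shows "0 \<le> quad p r1 r2 A B C y u + (A + 2 * B * a + C * a^2) * (- s1 * s2)"
proof -
  have "0 \<le> s2 * quad p r1 r2 A B C (y + s1) (u + a * s1)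
      + (- s1) * quad p r1 r2 A B C (y + s2) (u + a * s2)"
    using assms by (intro add_nonneg_nonneg mult_nonneg_nonneg) auto
  also have "\<dots> = (s2 - s1) * (quad p r1 r2 A B C y u + (A + 2 * B * a + C * a^2) * (- s1 * s2))"
    unfolding quad_def by (simp add: power2_eq_square algebra_simps)
  finally show ?thesis
    using assms(3) by (simp add: zero_le_mult_iff)
qed

text \<open>Replacing the covariance matrix by the rank-one matrix of \<open>v (x + a z)^2\<close>
  keeps the mixed entry and only lowers the diagonal, which is weighted by \<open>A\<close> and
  \<open>C\<close>.\<close>

lemma quad_moments_ge:
  assumes "0 \<le> A" "0 \<le> C" "v \<le> yy - y^2" "a^2 * v \<le> uu - u^2" "a * v = w - y * u"
  shows "quad p r1 r2 A B C y u + (A + 2 * B * a + C * a^2) * v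
    \<le> p + 2 * r1 * y + 2 * r2 * u + A * yy + 2 * B * w + C * uu"
proof -
  have "A * v \<le> A * (yy - y^2)" "C * (a^2 * v) \<le> C * (uu - u^2)"
    using assms by (auto intro: mult_left_mono)
  moreover have "B * (a * v) = B * (w - y * u)" using assms by simp
  ultimately show ?thesis unfolding quad_def by (simp add: algebra_simps)
qed

text \<open>If the covariance matrix of the moments is shrunk to a singular one, the moments live on a line of
  slope \<open>a\<close> through the mean \<open>(y, u)\<close>. On that line the form is either convex, with its mean in the
  region, and the value at the mean suffices, or it is compared with its chord between two points of the
  region.\<close>

lemma moments_nonneg:
  fixes y u yy w uu :: real
  assumes q: "\<And>y u. 0 \<le> y \<Longrightarrow> 0 \<le> u \<Longrightarrow> y * u \<le> 1 \<Longrightarrow> 0 \<le> quad p r1 r2 A B C y u"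
    and AC: "0 \<le> A" "0 \<le> C"
    and yu: "0 \<le> y" "0 \<le> u" and w: "0 \<le> w" "w \<le> 1" "w^2 \<le> y * u"
    and V: "0 \<le> yy - y^2" and U: "0 \<le> uu - u^2"
    and M: "(w - y * u)^2 \<le> (yy - y^2) * (uu - u^2)"
    and D1: "y * u < w \<Longrightarrow> w * (w - y * u)^2 \<le> u^2 * (1 - w) * (yy - y^2)"
    and D2: "y * u < w \<Longrightarrow> w * (w - y * u)^2 \<le> y^2 * (1 - w) * (uu - u^2)"
  shows "0 \<le> p + 2 * r1 * y + 2 * r2 * u + A * yy + 2 * B * w + C * uu"
proof -
  define V where "V = yy - y^2"
  define U where "U = uu - u^2"
  define c where "c = w - y * u"
  note ge = quad_moments_ge[OF AC, where y = y and u = u and yy = yy and uu = uu and w = w,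
      folded V_def U_def c_def]
  consider "c = 0" | "c < 0" | "c > 0" by linarith
  then show ?thesis
  proof cases
    case 1
    then have "y * u \<le> 1" using w by (simp add: c_def)
    then have "0 \<le> quad p r1 r2 A B C y u" using q yu by blast
    with ge[where v = 0 and a = 0 and p = p and ?r1.0 = r1 and ?r2.0 = r2 and B = B] 1 V U
    show ?thesis by (simp add: V_def U_def)
  next
    case 2
    have c2: "0 < c^2" using 2 by simp
    have cVU: "c^2 \<le> V * U" using M by (simp add: V_def U_def c_def)
    have Vpos: "0 < V" using c2 cVU V by (cases "V = 0") (auto simp: V_def)
    \<comment> \<open>Slope \<open>- g\<close> with \<open>v = V\<close> keeps the full variance of
      \<open>y\<close>.\<close>
    define g where "g = - c / V"
    have g: "0 < g" using 2 Vpos by (simp add: g_def divide_neg_pos)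
    have gV: "g * V = - c" using Vpos by (simp add: g_def)
    have "g^2 * V = c^2 / V" using Vpos by (simp add: g_def power2_eq_square)
    also have "\<dots> \<le> U" using cVU Vpos by (simp add: divide_le_eq mult.commute)
    finally have "quad p r1 r2 A B C y u + (A + 2 * B * (- g) + C * (- g)^2) * V
      \<le> p + 2 * r1 * y + 2 * r2 * u + A * yy + 2 * B * w + C * uu" (is "?q + ?G * V \<le> _")
      using ge[where v = V and a = "- g"] gV by simp
    moreover have "0 \<le> ?q + ?G * V"
    proof (cases "?G \<le> 0")
      \<comment> \<open>The chord joins the intersections of the line with the two axes;
        \<open>g * V = y * u - w\<close> is at most \<open>y * u\<close>.\<close>
      case True
      have ypos: "0 < y" "0 < u" using yu w 2 unfolding c_def
        by (metis add.right_neutral diff_0_right leD less_eq_real_def mult_zero_left mult_zero_right)+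
      have "0 \<le> ?q + ?G * (- (- y) * (u / g))"
      proof (rule quad_chord)
        have z: "u + - g * (u / g) = 0" using g by simp
        show "0 \<le> quad p r1 r2 A B C (y + u / g) (u + - g * (u / g))"
          unfolding z using q[of "y + u / g" 0] ypos g by simp
        show "0 \<le> quad p r1 r2 A B C (y + - y) (u + - g * - y)"
          using q[of 0 "u + g * y"] ypos g by simp
        show "- y < u / g" using ypos g by (smt (verit) divide_pos_pos)
      qed (use ypos g in auto)
      moreover have "V \<le> y * (u / g)"
        using gV g w(1) by (simp add: le_divide_eq c_def mult.commute)
      then have "?G * (y * (u / g)) \<le> ?G * V" using True by (rule mult_left_mono_neg)
      ultimately show ?thesis by simp
    next
      case G: False
      show ?thesis
      proof (cases "y * u \<le> 1")
        case True
        then have "0 \<le> ?q" using q yu by blast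
        then show ?thesis using G Vpos by (simp add: not_le)
      next
        case False
        \<comment> \<open>The mean lies beyond the hyperbola, so the chord joins the two points
          where the line meets \<open>y u = 1\<close>.\<close>
        let ?h = "\<lambda>s. (y + s) * (u - g * s)"
        have "\<exists>s\<ge>-y. s \<le> 0 \<and> ?h s = 1"
          by (rule IVT') (use yu False in \<open>auto intro!: continuous_intros\<close>)
        then obtain s1 where s1: "-y \<le> s1" "s1 \<le> 0" "?h s1 = 1" by blast
        have "\<exists>s\<ge>0. s \<le> u / g \<and> ?h s = 1"
          by (rule IVT2') (use yu g False in \<open>auto intro!: continuous_intros\<close>)
        then obtain s2 where s2: "0 \<le> s2" "s2 \<le> u / g" "?h s2 = 1" by blast
        have ne: "s1 < s2" using s1 s2 False by (cases "s1 = 0"; cases "s2 = 0") auto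
        have e1: "(y + s1) * (u + - g * s1) = 1" "(y + s2) * (u + - g * s2) = 1"
          using s1 s2 by simp_all
        have gs: "g * s1 \<le> 0" "g * s2 \<le> u" using s1 s2 g by (auto simp: mult_le_0_iff le_divide_eq mult.commute)
        have "0 \<le> ?q + ?G * (- s1 * s2)"
          by (rule quad_chord[OF s1(2) s2(1) ne]) (intro q; use e1 s1 s2 yu gs in simp)+
        moreover have "- s1 * s2 \<le> V"
        proof -
          \<comment> \<open>Vieta's formula for the product of the roots of
            \<open>?h s = 1\<close>.\<close>
          have "(s2 - s1) * (g * (- s1 * s2)) = (s2 - s1) * (y * u - 1) 
             - s2 * (?h s1 - 1) + s1 * (?h s2 - 1)"
            by (simp add: algebra_simps)
          then have "(s2 - s1) * (g * (- s1 * s2)) = (s2 - s1) * (y * u - 1)" using s1 s2 by simp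
          then have "g * (- s1 * s2) = y * u - 1" using ne by (metis mult_left_cancel right_minus_eq order_less_irrefl)
          also have "\<dots> \<le> g * V" using gV w by (simp add: c_def)
          finally show ?thesis using g by (meson mult_le_cancel_left_pos)
        qed
        then have "?G * (- s1 * s2) \<le> ?G * V" using G by (intro mult_left_mono) auto
        ultimately show ?thesis by linarith
      qed
    qed
    ultimately show ?thesis by linarith
  next
    case 3
    have c2: "0 < c^2" using 3 by simp
    have cVU: "c^2 \<le> V * U" using M by (simp add: V_def U_def c_def)
    have Vpos: "0 < V" using c2 cVU V by (cases "V = 0") (auto simp: V_def)
    have yult: "y * u < w" using 3 by (simp add: c_def)
    have wpos: "0 < w" using yult yu by (smt (verit) mult_nonneg_nonneg)
    have wlt: "w < 1" using w yult by (cases "w = 1") auto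
    have "0 < w^2" using wpos by simp
    then have "0 < y * u" using w by linarith
    then have pos: "0 < y" "0 < u" using yu by (auto simp: zero_less_mult_iff)
    \<comment> \<open>Any slope with \<open>c / V \<le> a \<le> U / c\<close> and \<open>w c / (y\<^sup>2 (1 - w)) \<le> a \<le> u\<^sup>2 (1 - w) / (w c)\<close> works; the first
      interval fits under the covariance matrix, the second puts the chord's endpoints into the region.\<close>
    define a where "a = max (c / V) (w * c / (y^2 * (1 - w)))"
    have a1: "c \<le> a * V"
      using Vpos by (simp add: a_def max_def field_simps)
    have "w * c / (y^2 * (1 - w)) \<le> a" by (simp add: a_def)
    then have a2: "w * c \<le> a * (y^2 * (1 - w))"
      using pos wlt by (simp add: divide_le_eq)
    have D1': "w * c^2 \<le> u^2 * (1 - w) * V" and D2': "w * c^2 \<le> y^2 * (1 - w) * U"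
      using D1 D2 yult by (auto simp: c_def V_def U_def)
    have apos: "0 < a" using a1 3 Vpos by (smt (verit) mult_nonpos_nonneg)
    \<comment> \<open>The two intervals for \<open>a\<close> meet because each lower bound is below
      each upper bound: \<open>cVU\<close>, \<open>D1'\<close> and \<open>D2'\<close> give three of
      the comparisons, \<open>w^2 \<le> y * u\<close> the fourth.\<close>
    have a3: "a * c \<le> U"
    proof -
      have "c / V * c \<le> U" using cVU Vpos by (simp add: divide_le_eq power2_eq_square mult.commute)
      moreover have "w * c / (y^2 * (1 - w)) * c \<le> U"
        using D2' pos wlt by (simp add: divide_le_eq power2_eq_square mult_ac)
      ultimately show ?thesis by (simp add: a_def max_def)
    qed
    have a4: "a * (w * c) \<le> u^2 * (1 - w)"
    proof -
      have "c / V * (w * c) \<le> u^2 * (1 - w)"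
        using D1' Vpos by (simp add: divide_le_eq power2_eq_square mult_ac)
      moreover have "w * c / (y^2 * (1 - w)) * (w * c) \<le> u^2 * (1 - w)"
      proof -
        have "w * c \<le> (y * u) * (1 - w)"
          using w(3) by (simp add: c_def power2_eq_square algebra_simps)
        then have "(w * c)^2 \<le> ((y * u) * (1 - w))^2"
          using wpos 3 by (intro power_mono) auto
        then show ?thesis using pos wlt
          by (simp add: divide_le_eq power2_eq_square mult_ac)
      qed
      ultimately show ?thesis by (simp add: a_def max_def)
    qed
    have av: "a * (c / a) = c" using apos by simp
    have "c / a \<le> V" using a1 apos by (simp add: divide_le_eq mult.commute)
    moreover have "a^2 * (c / a) \<le> U" using a3 apos by (simp add: power2_eq_square)
    ultimately have "quad p r1 r2 A B C y u + (A + 2 * B * a + C * a^2) * (c / a)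
      \<le> p + 2 * r1 * y + 2 * r2 * u + A * yy + 2 * B * w + C * uu" (is "?q + ?G * _ \<le> _")
      using ge[where v = "c / a" and a = a] av by simp
    \<comment> \<open>The chord starts where the rising line enters the quadrant, on
      \<open>u = 0\<close> or on \<open>y = 0\<close>. Its other end is chosen to make
      \<open>- s1 * s2 = c / a\<close>; \<open>a4\<close> respectively \<open>a2\<close> puts it
      below the hyperbola.\<close>
    moreover have "0 \<le> ?q + ?G * (c / a)"
    proof (cases "u \<le> a * y")
      case True
      have "0 \<le> ?q + ?G * (- (- u / a) * (c / u))"
      proof (rule quad_chord)
        show "0 \<le> quad p r1 r2 A B C (y + - u / a) (u + a * (- u / a))"
          by (rule q) (use True apos in \<open>simp_all add: divide_le_eq mult.commute\<close>)
        show "0 \<le> quad p r1 r2 A B C (y + c / u) (u + a * (c / u))"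
        proof (rule q)
          have "(y + c / u) * (u + a * (c / u)) = (w * u^2 + a * (w * c)) / u^2"
            using pos by (simp add: c_def field_simps power2_eq_square)
          also have "\<dots> \<le> 1" using a4 pos by (simp add: divide_le_eq algebra_simps)
          finally show "(y + c / u) * (u + a * (c / u)) \<le> 1" .
        qed (use pos 3 apos in auto)
        have "- u / a < 0" "0 < c / u" using pos 3 apos by auto
        then show "- u / a < c / u" by linarith
      qed (use pos 3 apos in auto)
      then show ?thesis using pos by simp
    next
      case False
      have "0 \<le> ?q + ?G * (- (- y) * (c / (a * y)))"
      proof (rule quad_chord)
        show "0 \<le> quad p r1 r2 A B C (y + - y) (u + a * (- y))"
          by (rule q) (use False in simp_all)
        show "0 \<le> quad p r1 r2 A B C (y + c / (a * y)) (u + a * (c / (a * y)))"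
        proof (rule q)
          have "(y + c / (a * y)) * (u + a * (c / (a * y))) = (w * (a * y^2) + w * c) / (a * y^2)"
            using pos apos by (simp add: c_def field_simps power2_eq_square)
          also have "\<dots> \<le> 1" using a2 pos apos by (simp add: divide_le_eq algebra_simps)
          finally show "(y + c / (a * y)) * (u + a * (c / (a * y))) \<le> 1" .
        qed (use pos 3 apos in auto)
        have "0 < c / (a * y)" using pos 3 apos by auto
        then show "- y < c / (a * y)" using pos by linarith
      qed (use pos 3 apos in auto)
      then show ?thesis using pos by simp
    qed
    ultimately show ?thesis by linarith
  qed
qed

subsection \<open>The cone of certifiable quadratics and its dual\<close>

definition cert :: "real \<Rightarrow> real \<Rightarrow> real \<Rightarrow> real \<Rightarrow> real \<Rightarrow> real \<Rightarrow> (nat \<Rightarrow> real) \<Rightarrow> bool" where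
  "cert p r1 r2 A B C t \<longleftrightarrow>
    psd3 (p - t 11 - t 19) (r1 - t 1 / 2 - t 8 - t 12 / 2) (r2 - t 3 / 2 - t 4 / 2 - t 16)
      (A - t 6) (B - t 2 - t 5 - t 13 - (1/2) * (t 9 - t 11 + t 17 - t 19)) (C - t 14) \<and>
    psd2 (t 1) (t 2) (t 3) \<and>
    psd2 (t 4) (t 5) (2 * (t 8 - t 7)) \<and>
    psd3 (t 6) (t 7) (t 8) (t 9) (t 10) (t 11) \<and>
    psd2 (t 12) (t 13) (2 * (t 16 - t 15)) \<and>
    psd3 (t 14) (t 15) (t 16) (t 17) (t 18) (t 19)"

definition certifiable :: "real \<Rightarrow> real \<Rightarrow> real \<Rightarrow> real \<Rightarrow> real \<Rightarrow> real \<Rightarrow> bool" where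
  "certifiable p r1 r2 A B C \<longleftrightarrow> (\<exists>t. cert p r1 r2 A B C t)"

lemma psd2_swap: "psd2 a b c \<longleftrightarrow> psd2 c b a"
proof -
  have "psd2 c b a" if "psd2 a b c" for a b c
    unfolding psd2_def
  proof (intro allI)
    fix x y
    show "0 \<le> c * x\<^sup>2 + 2 * b * x * y + a * y\<^sup>2"
      using that[unfolded psd2_def, rule_format, of y x] by (simp add: algebra_simps)
  qed
  then show ?thesis by blast
qed

lemma psd3_swap: "psd3 a b c d e f \<longleftrightarrow> psd3 a c b f e d"
proof -
  have "psd3 a c b f e d" if "psd3 a b c d e f" for a b c d e f
    unfolding psd3_def
  proof (intro allI)
    fix x y z
    show "0 \<le> a * x\<^sup>2 + f * y\<^sup>2 + d * z\<^sup>2 + 2 * c * x * y + 2 * b * x * z + 2 * e * y * z"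
      using that[unfolded psd3_def, rule_format, of x z y] by (simp add: algebra_simps)
  qed
  then show ?thesis by blast
qed

lemma psd2_det: assumes "psd2 a b c" shows "0 \<le> a" "0 \<le> c" "b^2 \<le> a * c"
proof -
  note p = assms[unfolded psd2_def, rule_format]
  show a: "0 \<le> a" using p[of 1 0] by simp
  show "0 \<le> c" using p[of 0 1] by simp
  show "b^2 \<le> a * c"
  proof (cases "a = 0")
    case True
    have "b = 0"
    proof (rule ccontr)
      assume b: "b \<noteq> 0"
      \<comment> \<open>For \<open>a = 0\<close> the form is affine in \<open>x\<close>; this
        \<open>x\<close> makes it \<open>-1\<close>.\<close>
      have "0 \<le> 2 * b * (- (c + 1) / (2 * b)) + c" using p[of "- (c + 1) / (2 * b)" 1] True by simp
      then show False using b by simp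
    qed
    then show ?thesis using True by simp
  next
    case False
    have "0 \<le> a * (a * c - b^2)"
      using p[of "- b" a] by (simp add: power2_eq_square algebra_simps)
    then show ?thesis using a False by (simp add: zero_le_mult_iff)
  qed
qed

lemma certifiable_swap:
  assumes "certifiable p r1 r2 A B C" shows "certifiable p r2 r1 C B A"
proof -
  obtain t where t: "cert p r1 r2 A B C t" using assms by (auto simp: certifiable_def)
  \<comment> \<open>This reverses \<open>Lam2\<close> and exchanges \<open>t 4, ..., t 11\<close>
    with \<open>t 12, ..., t 19\<close>.\<close>
  define t' where "t' i = t (if i = 1 then 3 else if i = 2 then 2 else if i = 3 then 1
      else if i < 12 then i + 8 else i - 8)" for i
  have "cert p r2 r1 C B A t'"
    using t psd2_swap[of "t 1" "t 2" "t 3"]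
      psd3_swap[of "p - t 11 - t 19" "r1 - t 1 / 2 - t 8 - t 12 / 2"
        "r2 - t 3 / 2 - t 4 / 2 - t 16" "A - t 6"
        "B - t 2 - t 5 - t 13 - (1/2) * (t 9 - t 11 + t 17 - t 19)" "C - t 14"]
    unfolding cert_def t'_def
    by (simp add: algebra_simps)
  then show ?thesis by (auto simp: certifiable_def)
qed

section \<open>Explicit certifiable forms\<close>

lemma certifiable_square: "certifiable (a^2) (a * b) (a * c) (b^2) (b * c) (c^2)"
proof -
  \<comment> \<open>With \<open>t = 0\<close> only \<open>Lam1\<close> remains, the rank-one matrix
    of \<open>(a + b y + c u)^2\<close>.\<close>
  have "cert (a^2) (a * b) (a * c) (b^2) (b * c) (c^2) (\<lambda>_. 0)"
    unfolding cert_def psd2_def psd3_def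
  proof (intro conjI allI)
    fix x y z
    have "0 \<le> (a * x + b * y + c * z)^2" by simp
    also have "\<dots> = a^2 * x^2 + b^2 * y^2 + c^2 * z^2 + 2 * (a * b) * x * y + 2 * (a * c) * x * z + 2 * (b * c) * y * z"
      by (simp add: power2_eq_square algebra_simps)
    finally show "0 \<le> (a\<^sup>2 - 0 - 0) * x\<^sup>2 + (b\<^sup>2 - 0) * y\<^sup>2 + (c\<^sup>2 - 0) * z\<^sup>2 
      + 2 * (a * b - 0 / 2 - 0 - 0 / 2) * x * y + 2 * (a * c - 0 / 2 - 0 / 2 - 0) * x * z
      + 2 * (b * c - 0 - 0 - 0 - 1 / 2 * (0 - 0 + 0 - 0)) * y * z" by simp
  qed simp_all
  then show ?thesis by (auto simp: certifiable_def)
qed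

text \<open>The form is \<open>y (a + b u)^2 + b^2 u (1 - y u)\<close>, the contribution of
  \<open>Lam2\<close>. It yields \<open>w^2 \<le> y * u\<close>.\<close>

lemma certifiable_tangent: "certifiable 0 (a^2 / 2) (b^2 / 2) 0 (a * b) 0"
proof -
  have "cert 0 (a^2 / 2) (b^2 / 2) 0 (a * b) 0 ((\<lambda>_. 0)(1 := a^2, 2 := a * b, 3 := b^2))"
    unfolding cert_def psd2_def psd3_def
  proof (simp, intro allI)
    fix x y
    have "0 \<le> (a * x + b * y)^2" by simp
    then show "0 \<le> a\<^sup>2 * x\<^sup>2 + 2 * (a * b) * x * y + b\<^sup>2 * y\<^sup>2"
      by (simp add: power2_eq_square algebra_simps)
  qed
  then show ?thesis by (auto simp: certifiable_def)
qed

lemma certifiable_yu: "certifiable 0 0 0 0 (1/2) 0"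
proof -
  have "cert 0 0 0 0 (1/2) 0 ((\<lambda>_. 0)(9 := 1))"
    unfolding cert_def psd2_def psd3_def by simp
  then show ?thesis by (auto simp: certifiable_def)
qed

lemma certifiable_one_minus_yu: "certifiable 1 0 0 0 (- 1/2) 0"
proof -
  have "cert 1 0 0 0 (- 1/2) 0 ((\<lambda>_. 0)(11 := 1))"
    unfolding cert_def psd2_def psd3_def by simp
  then show ?thesis by (auto simp: certifiable_def)
qed

text \<open>This form vanishes at \<open>(y0, 0)\<close> on the edge and touches zero along the hyperbola
  \<open>y u = 1\<close> at \<open>(y1, 1 / y1)\<close>.\<close>

lemma certifiable_edge:
  assumes "y0 \<le> y1"
  shows "certifiable (y0^2) (- y0) ((y1 - y0) * y1^2) 1 (- 2 * (y1 - y0) * y1 + (y1^2 - y0^2) / 2) 0"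
proof -
  have 1: "psd2 (2 * (y1 - y0) * y1^2) (- 2 * (y1 - y0) * y1) (2 * (- y0 - - y1))"
    unfolding psd2_def
  proof (intro allI)
    fix x y
    have "0 \<le> 2 * (y1 - y0) * (y1 * x - y)^2" using assms by simp
    then show "0 \<le> 2 * (y1 - y0) * y1\<^sup>2 * x\<^sup>2 + 2 * (- 2 * (y1 - y0) * y1) * x * y + 2 * (- y0 - - y1) * y\<^sup>2"
      by (simp add: power2_eq_square algebra_simps)
  qed
  have 2: "psd3 1 (- y1) (- y0) (y1^2) (y0 * y1) (y0^2)"
    unfolding psd3_def
  proof (intro allI)
    fix x y z
    have "0 \<le> (x - y1 * y - y0 * z)^2" by simp
    then show "0 \<le> 1 * x\<^sup>2 + y1\<^sup>2 * y\<^sup>2 + y0\<^sup>2 * z\<^sup>2 + 2 * - y1 * x * y + 2 * - y0 * x * z + 2 * (y0 * y1) * y * z"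
      by (simp add: power2_eq_square algebra_simps)
  qed
  have 4: "(y1 - y0) * y1\<^sup>2 - (2 * y1 - 2 * y0) * y1\<^sup>2 / 2 = 0"
    by (simp add: field_simps)
  have 3: "psd3 0 0 0 0 0 0" "psd2 0 0 0" by (simp_all add: psd2_def psd3_def)
  \<comment> \<open>Only \<open>Lam3\<close> and \<open>Lam4\<close> are nonzero: the form is
    \<open>2 (y1 - y0) u (y - y1)^2 + y u (y - y1)^2 + (1 - y u) (y - y0)^2\<close>.\<close>
  have "cert (y0^2) (- y0) ((y1 - y0) * y1^2) 1 (- 2 * (y1 - y0) * y1 + (y1^2 - y0^2) / 2) 0
    ((\<lambda>_. 0)(4 := 2 * (y1 - y0) * y1^2, 5 := - 2 * (y1 - y0) * y1, 6 := 1, 7 := - y1, 8 := - y0,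
       9 := y1^2, 10 := y0 * y1, 11 := y0^2))"
    using 1 2 3 unfolding cert_def by (simp add: 4)
  then show ?thesis by (auto simp: certifiable_def)
qed

text \<open>The bound is the one attained by the measure with mass \<open>w\<close> at \<open>(w / u, u / w)\<close> and mass \<open>1 - w\<close>
  at a point of the line \<open>u = 0\<close>; these two points are the zeros of the form used.\<close>

lemma edge_moment_bound:
  assumes L: "\<And>p r1 r2 A B C. certifiable p r1 r2 A B C \<Longrightarrow>
      0 \<le> p + 2 * r1 * y + 2 * r2 * u + A * yy + 2 * B * w + C * uu"
    and "0 < u" "w < 1" "y * u < w"
  shows "w * (w - y * u)^2 \<le> u^2 * (1 - w) * (yy - y^2)"
proof -
  define y1 where "y1 = w / u"
  \<comment> \<open>The point on \<open>u = 0\<close> is \<open>(y1 - d, 0)\<close>; this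
    \<open>d\<close> gives the two-point measure the mean \<open>y\<close>.\<close>
  define d where "d = (w - y * u) / (u * (1 - w))"
  have d: "0 < d" using assms by (simp add: d_def)
  have uy1: "y1 * u = w" using assms by (simp add: y1_def)
  have "d * (1 - w) = (w - y * u) / u" using assms by (simp add: d_def)
  also have "\<dots> = y1 - y" using assms by (simp add: y1_def field_simps)
  finally have y: "y = y1 - d * (1 - w)" by simp
  have "0 \<le> (y1 - d)^2 + 2 * (- (y1 - d)) * y + 2 * (d * y1^2) * u + yy
      + 2 * (- 2 * d * y1 + (y1^2 - (y1 - d)^2) / 2) * w"
    using L[OF certifiable_edge[of "y1 - d" y1]] d by simp
  also have "\<dots> = (y1 - d)^2 + 2 * (- (y1 - d)) * y + 2 * d * y1 * (y1 * u) + yy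
      + 2 * (- 2 * d * y1 + (y1^2 - (y1 - d)^2) / 2) * w"
    by (simp add: power2_eq_square algebra_simps)
  \<comment> \<open>The subtracted term is the variance of the first coordinate under the two-point
    measure.\<close>
  also have "\<dots> = (yy - y^2) - w * (1 - w) * d^2"
    unfolding uy1 by (subst (1 2) y) (simp add: power2_eq_square field_simps)
  finally have "u^2 * (1 - w) * (w * (1 - w) * d^2) \<le> u^2 * (1 - w) * (yy - y^2)"
    using assms by (intro mult_left_mono) auto
  moreover have "u^2 * (1 - w) * (w * (1 - w) * d^2) = w * (u * (1 - w) * d)^2"
    by (simp add: power2_eq_square algebra_simps)
  moreover have "u * (1 - w) * d = w - y * u" using assms by (simp add: d_def)
  ultimately show ?thesis by simp
qed

section \<open>Nonnegativity of the dual functional\<close>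

lemma dual_nonneg_normalized:
  assumes L: "\<And>p r1 r2 A B C. certifiable p r1 r2 A B C \<Longrightarrow>
      0 \<le> p + 2 * r1 * y + 2 * r2 * u + A * yy + 2 * B * w + C * uu"
    and q: "\<And>y u. 0 \<le> y \<Longrightarrow> 0 \<le> u \<Longrightarrow> y * u \<le> 1 \<Longrightarrow> 0 \<le> quad p r1 r2 A B C y u"
    and AC: "0 \<le> A" "0 \<le> C"
  shows "0 \<le> p + 2 * r1 * y + 2 * r2 * u + A * yy + 2 * B * w + C * uu"
proof (rule moments_nonneg[OF q AC])
  have "psd2 (yy - y^2) (w - y * u) (uu - u^2)"
    unfolding psd2_def
  proof (intro allI)
    fix b c
    show "0 \<le> (yy - y\<^sup>2) * b\<^sup>2 + 2 * (w - y * u) * b * c + (uu - u\<^sup>2) * c\<^sup>2"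
      \<comment> \<open>The constant term centres the affine form at the mean, so its square tests
        the covariance matrix.\<close>
      using L[OF certifiable_square[of "- (b * y + c * u)" b c]]
      by (simp add: power2_eq_square algebra_simps)
  qed
  from psd2_det[OF this]
  show "0 \<le> yy - y\<^sup>2" "0 \<le> uu - u\<^sup>2" "(w - y * u)\<^sup>2 \<le> (yy - y\<^sup>2) * (uu - u\<^sup>2)" by auto
  have "psd2 y w u"
    unfolding psd2_def
  proof (intro allI)
    fix a b
    show "0 \<le> y * a\<^sup>2 + 2 * w * a * b + u * b\<^sup>2"
      using L[OF certifiable_tangent[of a b]] by (simp add: power2_eq_square algebra_simps)
  qed
  from psd2_det[OF this] show yu: "0 \<le> y" "0 \<le> u" "w\<^sup>2 \<le> y * u" by auto
  show w: "0 \<le> w" "w \<le> 1"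
    using L[OF certifiable_yu] L[OF certifiable_one_minus_yu] by auto
  have pos: "0 < y" "0 < u" "w < 1" if "y * u < w"
  proof -
    have "0 < w" using that yu by (smt (verit) mult_nonneg_nonneg)
    then have "0 < w^2" by simp
    then have "0 < y * u" using yu by linarith
    then show "0 < y" "0 < u" using yu by (auto simp: zero_less_mult_iff)
    show "w < 1" using that w yu by (cases "w = 1") auto
  qed
  show "w * (w - y * u)\<^sup>2 \<le> u\<^sup>2 * (1 - w) * (yy - y\<^sup>2)" if "y * u < w"
    using edge_moment_bound[OF L] pos[OF that] that by blast
  show "w * (w - y * u)\<^sup>2 \<le> y\<^sup>2 * (1 - w) * (uu - u\<^sup>2)" if "y * u < w"
  proof -
    have "0 \<le> p + 2 * r1 * u + 2 * r2 * y + A * uu + 2 * B * w + C * yy"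
      if "certifiable p r1 r2 A B C" for p r1 r2 A B C
      using L[OF certifiable_swap[OF that]] by (simp add: algebra_simps)
    then show ?thesis using edge_moment_bound[of u y uu w yy] pos[OF that] that
      by (simp add: mult.commute)
  qed
qed

text \<open>Positive mass \<open>m\<close> is normalized to 1. For \<open>m = 0\<close>
  Cauchy-Schwarz and \<open>0 \<le> w \<le> m\<close> leave only
  \<open>A * yy + C * uu\<close>.\<close>

lemma dual_nonneg:
  assumes L: "\<And>p r1 r2 A B C. certifiable p r1 r2 A B C \<Longrightarrow>
      0 \<le> p * m + 2 * r1 * y + 2 * r2 * u + A * yy + 2 * B * w + C * uu"
    and q: "\<And>y u. 0 \<le> y \<Longrightarrow> 0 \<le> u \<Longrightarrow> y * u \<le> 1 \<Longrightarrow> 0 \<le> quad p r1 r2 A B C y u"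
    and AC: "0 \<le> A" "0 \<le> C"
  shows "0 \<le> p * m + 2 * r1 * y + 2 * r2 * u + A * yy + 2 * B * w + C * uu"
proof -
  have m: "0 \<le> m" using L[OF certifiable_square[of 1 0 0]] by simp
  have yyuu: "0 \<le> yy" "0 \<le> uu"
    using L[OF certifiable_square[of 0 1 0]] L[OF certifiable_square[of 0 0 1]] by simp_all
  show ?thesis
  proof (cases "m = 0")
    case True
    have "psd2 m y yy" "psd2 m u uu"
      unfolding psd2_def using L[OF certifiable_square[of _ _ 0]] L[OF certifiable_square[of _ 0 _]]
      by (simp_all add: power2_eq_square algebra_simps)
    from this[THEN psd2_det(3)] True have "y = 0" "u = 0" by simp_all
    moreover have "w = 0"
      using L[OF certifiable_yu] L[OF certifiable_one_minus_yu] True by auto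
    ultimately show ?thesis using True AC yyuu by simp
  next
    case False
    then have m: "0 < m" using m by simp
    have scale: "p + 2 * r1 * (y / m) + 2 * r2 * (u / m) + A * (yy / m) + 2 * B * (w / m) + C * (uu / m)
      = (p * m + 2 * r1 * y + 2 * r2 * u + A * yy + 2 * B * w + C * uu) / m" for p r1 r2 A B C
      using m by (simp add: field_simps)
    have "0 \<le> p + 2 * r1 * (y / m) + 2 * r2 * (u / m) + A * (yy / m) + 2 * B * (w / m) + C * (uu / m)"
    proof (rule dual_nonneg_normalized[OF _ q AC])
      fix p r1 r2 A B C assume "certifiable p r1 r2 A B C"
      from L[OF this] m
      show "0 \<le> p + 2 * r1 * (y / m) + 2 * r2 * (u / m) + A * (yy / m) + 2 * B * (w / m) + C * (uu / m)"
        unfolding scale by (intro divide_nonneg_pos)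
    qed
    then have "0 \<le> (p * m + 2 * r1 * y + 2 * r2 * u + A * yy + 2 * B * w + C * uu) / m"
      unfolding scale .
    then show ?thesis using m by (simp add: zero_le_divide_iff)
  qed
qed

subsection \<open>Closedness of the cone\<close>

lemma psd2_offdiag:
  assumes "psd2 a b c" shows "2 * b \<le> a + c" "- 2 * b \<le> a + c"
  using assms[unfolded psd2_def, rule_format, of 1 1] assms[unfolded psd2_def, rule_format, of 1 "-1"]
  by simp_all

lemma psd3_minors:
  assumes "psd3 a b c d e f" shows "psd2 a b d" "psd2 a c f" "psd2 d e f"
proof -
  note p = assms[unfolded psd3_def, rule_format]
  show "psd2 a b d" using p[of _ _ 0] by (simp add: psd2_def algebra_simps)
  show "psd2 a c f" using p[of _ 0 _] by (simp add: psd2_def algebra_simps)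
  show "psd2 d e f" using p[of 0 _ _] by (simp add: psd2_def algebra_simps)
qed

text \<open>Every bound propagates from the diagonal of \<open>Lam1\<close> except for a cycle: \<open>t 9\<close> is controlled
  through \<open>t 5\<close>, \<open>t 5\<close> through \<open>t 7\<close>, and \<open>t 7\<close> through \<open>t 9\<close>. Testing with the vector \<open>(8, 1)\<close> makes the
  last dependence contractive.\<close>

lemma cert_bounded:
  assumes "cert p r1 r2 A B C t" and N: "\<bar>p\<bar> \<le> N" "\<bar>r1\<bar> \<le> N" "\<bar>r2\<bar> \<le> N" "\<bar>A\<bar> \<le> N" "\<bar>B\<bar> \<le> N" "\<bar>C\<bar> \<le> N"
    and i: "i \<in> {1..19}"
  shows "\<bar>t i\<bar> \<le> 100 * N"
proof -
  have L1: "psd3 (p - t 11 - t 19) (r1 - t 1 / 2 - t 8 - t 12 / 2) (r2 - t 3 / 2 - t 4 / 2 - t 16)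
      (A - t 6) (B - t 2 - t 5 - t 13 - (1/2) * (t 9 - t 11 + t 17 - t 19)) (C - t 14)"
    and L2: "psd2 (t 1) (t 2) (t 3)"
    and L3: "psd2 (t 4) (t 5) (2 * (t 8 - t 7))"
    and L4: "psd3 (t 6) (t 7) (t 8) (t 9) (t 10) (t 11)"
    and L5: "psd2 (t 12) (t 13) (2 * (t 16 - t 15))"
    and L6: "psd3 (t 14) (t 15) (t 16) (t 17) (t 18) (t 19)"
    using assms(1) by (simp_all add: cert_def)
  note m1 = psd3_minors[OF L1] and m4 = psd3_minors[OF L4] and m6 = psd3_minors[OF L6]
  have diag: "0 \<le> t 1" "0 \<le> t 3" "0 \<le> t 4" "0 \<le> t 6" "0 \<le> t 9" "0 \<le> t 11"
    "0 \<le> t 12" "0 \<le> t 14" "0 \<le> t 17" "0 \<le> t 19"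
    using psd2_det[OF L2] psd2_det[OF L3] psd2_det[OF L5] psd2_det[OF m4(1)] psd2_det[OF m4(2)]
      psd2_det[OF m6(1)] psd2_det[OF m6(2)] by auto
  have d1: "t 11 + t 19 \<le> N" "t 6 \<le> N" "t 14 \<le> N"
    using psd2_det[OF m1(1)] psd2_det[OF m1(2)] N by auto
  note N' = N[THEN abs_le_D1] N[THEN abs_le_D2]
  have o8: "t 8 \<le> N" "- t 8 \<le> N" "t 16 \<le> N" "- t 16 \<le> N"
    using psd2_offdiag[OF m4(2)] psd2_offdiag[OF m6(2)] d1 diag by (simp_all add: field_simps)
  have a: "t 1 + t 12 \<le> 6 * N"
    using psd2_offdiag(2)[OF m1(1)] d1 diag o8 N' by (simp add: algebra_simps)
  have b: "t 3 + t 4 \<le> 6 * N"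
    using psd2_offdiag(2)[OF m1(2)] d1 diag o8 N' by (simp add: algebra_simps)
  have o2: "\<bar>t 2\<bar> \<le> 6 * N"
    unfolding abs_le_iff using psd2_offdiag[OF L2] a b diag by simp
  have o7: "\<bar>t 7\<bar> \<le> 4 * N + t 9 / 16" "\<bar>t 15\<bar> \<le> 4 * N + t 17 / 16"
    unfolding abs_le_iff
    using m4(1)[unfolded psd2_def, rule_format, of 8 1] m4(1)[unfolded psd2_def, rule_format, of 8 "-1"]
      m6(1)[unfolded psd2_def, rule_format, of 8 1] m6(1)[unfolded psd2_def, rule_format, of 8 "-1"] d1
    by simp_all
  note o2' = o2[THEN abs_le_D1] o2[THEN abs_le_D2] and o7' = o7[THEN abs_le_D1] o7[THEN abs_le_D2]
  have o5: "\<bar>t 5\<bar> \<le> 8 * N + t 9 / 16" "\<bar>t 13\<bar> \<le> 8 * N + t 17 / 16"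
    unfolding abs_le_iff using psd2_offdiag[OF L3] psd2_offdiag[OF L5] o7' o8 a b diag by simp_all
  note o5' = o5[THEN abs_le_D1] o5[THEN abs_le_D2]
  \<comment> \<open>Through \<open>t 5\<close> and \<open>t 13\<close> the right-hand side contains
    \<open>(t 9 + t 17) / 8\<close>, which is absorbed on the left.\<close>
  have c: "t 9 + t 17 \<le> 100 * N"
    using psd2_offdiag(2)[OF m1(3)] o5' o2' d1 diag N'
    by (simp add: algebra_simps)
  have o10: "\<bar>t 10\<bar> \<le> 100 * N" "\<bar>t 18\<bar> \<le> 100 * N"
    unfolding abs_le_iff using psd2_offdiag[OF m4(3)] psd2_offdiag[OF m6(3)] c d1 diag N' by simp_all
  have cases: "i = 1 \<or> i = 2 \<or> i = 3 \<or> i = 4 \<or> i = 5 \<or> i = 6 \<or> i = 7 \<or> i = 8 \<or> i = 9 \<or>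
      i = 10 \<or> i = 11 \<or> i = 12 \<or> i = 13 \<or> i = 14 \<or> i = 15 \<or> i = 16 \<or> i = 17 \<or> i = 18 \<or> i = 19"
    using i by (simp only: atLeastAtMost_iff) presburger
  have N0: "0 \<le> N" using d1(2) diag(4) by linarith
  have 1: "\<bar>t 1\<bar> \<le> 100 * N" "\<bar>t 12\<bar> \<le> 100 * N" "\<bar>t 3\<bar> \<le> 100 * N" "\<bar>t 4\<bar> \<le> 100 * N"
    using N0 a b diag(1,2,3,7) by simp_all
  have 2: "\<bar>t 9\<bar> \<le> 100 * N" "\<bar>t 17\<bar> \<le> 100 * N" using c diag(5,9) by simp_all
  have 3: "\<bar>t 6\<bar> \<le> 100 * N" "\<bar>t 11\<bar> \<le> 100 * N" "\<bar>t 14\<bar> \<le> 100 * N" "\<bar>t 19\<bar> \<le> 100 * N"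
    using N0 d1 diag(4,6,8,10) by simp_all
  have 4: "\<bar>t 8\<bar> \<le> 100 * N" "\<bar>t 16\<bar> \<le> 100 * N" "\<bar>t 2\<bar> \<le> 100 * N"
    using N0 o8 o2 by simp_all
  have 5: "\<bar>t 7\<bar> \<le> 100 * N" "\<bar>t 15\<bar> \<le> 100 * N" "\<bar>t 5\<bar> \<le> 100 * N" "\<bar>t 13\<bar> \<le> 100 * N"
    using N0 o7 o5 c diag(5,9) by simp_all
  show ?thesis using cases by (elim disjE) (simp_all only: 1 2 3 4 5 o10)
qed

text \<open>Allows the other values of \<open>t\<close> to be set to 0, so that certificates lie in
  a compact box.\<close>

lemma cert_cong:
  assumes "\<And>i. i \<in> {1..19} \<Longrightarrow> t i = t' i"
  shows "cert p r1 r2 A B C t \<longleftrightarrow> cert p r1 r2 A B C t'"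
  unfolding cert_def by (simp add: assms)

section \<open>Sums and nonnegative multiples of certificates\<close>

lemma psd2_add: "psd2 a b c \<Longrightarrow> psd2 a' b' c' \<Longrightarrow> psd2 (a + a') (b + b') (c + c')"
  unfolding psd2_def by (smt (verit) distrib_left distrib_right)

lemma psd3_add: "psd3 a b c d e f \<Longrightarrow> psd3 a' b' c' d' e' f' \<Longrightarrow>
   psd3 (a + a') (b + b') (c + c') (d + d') (e + e') (f + f')"
proof (unfold psd3_def, intro allI)
  fix x y z
  assume "\<forall>x y z. 0 \<le> a * x^2 + d * y^2 + f * z^2 + 2 * b * x * y + 2 * c * x * z + 2 * e * y * z"
    and "\<forall>x y z. 0 \<le> a' * x^2 + d' * y^2 + f' * z^2 + 2 * b' * x * y + 2 * c' * x * z + 2 * e' * y * z"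
  from add_nonneg_nonneg[OF this[rule_format, of x y z]]
  show "0 \<le> (a + a') * x^2 + (d + d') * y^2 + (f + f') * z^2
     + 2 * (b + b') * x * y + 2 * (c + c') * x * z + 2 * (e + e') * y * z"
    by (simp add: algebra_simps)
qed

lemma psd2_scale: assumes "0 \<le> k" "psd2 a b c" shows "psd2 (k * a) (k * b) (k * c)"
  unfolding psd2_def
proof (intro allI)
  fix x y
  have "0 \<le> k * (a * x^2 + 2 * b * x * y + c * y^2)" 
    using assms by (simp add: psd2_def)
  then show "0 \<le> k * a * x^2 + 2 * (k * b) * x * y + k * c * y^2" by (simp add: algebra_simps)
qed

lemma psd3_scale: assumes "0 \<le> k" "psd3 a b c d e f"
  shows "psd3 (k * a) (k * b) (k * c) (k * d) (k * e) (k * f)"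
  unfolding psd3_def
proof (intro allI)
  fix x y z
  have "0 \<le> k * (a * x^2 + d * y^2 + f * z^2 + 2 * b * x * y + 2 * c * x * z + 2 * e * y * z)"
    using assms by (simp add: psd3_def)
  then show "0 \<le> k * a * x^2 + k * d * y^2 + k * f * z^2 + 2 * (k * b) * x * y + 2 * (k * c) * x * z + 2 * (k * e) * y * z"
    by (simp add: algebra_simps)
qed

lemma cert_add:
  assumes "cert p r1 r2 A B C t" "cert p' r1' r2' A' B' C' t'"
  shows "cert (p + p') (r1 + r1') (r2 + r2') (A + A') (B + B') (C + C') (\<lambda>i. t i + t' i)"
proof -
  note c = assms[unfolded cert_def] and eq = algebra_simps add_divide_distrib diff_divide_distrib
  note c1 = c(1)[THEN conjunct1] c(2)[THEN conjunct1]
  note d2 = c(1)[THEN conjunct2] c(2)[THEN conjunct2]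
  note c2 = d2[THEN conjunct1] and d3 = d2[THEN conjunct2]
  note c3 = d3[THEN conjunct1] and d4 = d3[THEN conjunct2]
  note c4 = d4[THEN conjunct1] and d5 = d4[THEN conjunct2]
  note c5 = d5[THEN conjunct1] and c6 = d5[THEN conjunct2]
  show ?thesis
    unfolding cert_def
    using psd3_add[OF c1] psd2_add[OF c2] psd2_add[OF c3] psd3_add[OF c4] psd2_add[OF c5] psd3_add[OF c6]
    by (simp add: eq)
qed

lemma cert_scale:
  assumes "0 \<le> k" "cert p r1 r2 A B C t"
  shows "cert (k * p) (k * r1) (k * r2) (k * A) (k * B) (k * C) (\<lambda>i. k * t i)"
proof -
  note c = assms(2)[unfolded cert_def] and eq = algebra_simps add_divide_distrib diff_divide_distrib
  note c1 = c[THEN conjunct1] and d2 = c[THEN conjunct2]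
  note c2 = d2[THEN conjunct1] and d3 = d2[THEN conjunct2]
  note c3 = d3[THEN conjunct1] and d4 = d3[THEN conjunct2]
  note c4 = d4[THEN conjunct1] and d5 = d4[THEN conjunct2]
  note c5 = d5[THEN conjunct1] and c6 = d5[THEN conjunct2]
  note s2 = psd2_scale[OF assms(1)] and s3 = psd3_scale[OF assms(1)]
  show ?thesis
    unfolding cert_def
    using s3[OF c1] s2[OF c2] s2[OF c3] s3[OF c4] s2[OF c5] s3[OF c6]
    by (simp add: eq)
qed

type_synonym coeffs = "real \<times> real \<times> real \<times> real \<times> real \<times> real"

fun certc :: "coeffs \<Rightarrow> (nat \<Rightarrow> real) \<Rightarrow> bool" where
  "certc (p, r1, r2, A, B, C) t \<longleftrightarrow> cert p r1 r2 A B C t"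

definition cert_cone :: "coeffs set" where
  "cert_cone = {(p, r1, r2, A, B, C). certifiable p r1 r2 A B C}"

lemma cert_cone_iff: "k \<in> cert_cone \<longleftrightarrow> (\<exists>t. certc k t)"
  by (cases k) (simp add: cert_cone_def certifiable_def)

lemma certc_proj: "certc k t \<longleftrightarrow> cert (fst k) (fst (snd k)) (fst (snd (snd k)))
  (fst (snd (snd (snd k)))) (fst (snd (snd (snd (snd k))))) (snd (snd (snd (snd (snd k))))) t"
  by (cases k) simp

lemma closed_psd2:
  fixes a b c :: "'a::topological_space \<Rightarrow> real"
  assumes "continuous_on UNIV a" "continuous_on UNIV b" "continuous_on UNIV c"
  shows "closed {z. psd2 (a z) (b z) (c z)}"
  unfolding psd2_def by (intro closed_Collect_all closed_Collect_le continuous_intros assms)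

lemma closed_psd3:
  fixes a b c d e f :: "'a::topological_space \<Rightarrow> real"
  assumes "continuous_on UNIV a" "continuous_on UNIV b" "continuous_on UNIV c"
    and "continuous_on UNIV d" "continuous_on UNIV e" "continuous_on UNIV f"
  shows "closed {z. psd3 (a z) (b z) (c z) (d z) (e z) (f z)}"
  unfolding psd3_def by (intro closed_Collect_all closed_Collect_le continuous_intros assms)

lemma closed_cert:
  fixes p r1 r2 A B C :: "'a::topological_space \<Rightarrow> real"
  assumes "continuous_on UNIV p" "continuous_on UNIV r1" "continuous_on UNIV r2"
    and "continuous_on UNIV A" "continuous_on UNIV B" "continuous_on UNIV C"
    and "\<And>i. continuous_on UNIV (t i)"
  shows "closed {z. cert (p z) (r1 z) (r2 z) (A z) (B z) (C z) (\<lambda>i. t i z)}"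
  unfolding cert_def
  by (intro closed_Collect_conj closed_psd2 closed_psd3 continuous_on_add continuous_on_diff
      continuous_on_mult continuous_on_divide continuous_on_const assms) simp_all

lemma closed_certc_graph: "closed {z. certc (fst z) (snd z)}"
proof -
  have "continuous_on UNIV (\<lambda>z::coeffs \<times> (nat \<Rightarrow> real). snd z i)" for i
    by (rule continuous_on_product_then_coordinatewise[OF continuous_on_snd[OF continuous_on_id]])
  then have "closed {z::coeffs \<times> (nat \<Rightarrow> real). cert (fst (fst z)) (fst (snd (fst z)))
      (fst (snd (snd (fst z)))) (fst (snd (snd (snd (fst z))))) (fst (snd (snd (snd (snd (fst z))))))
      (snd (snd (snd (snd (snd (fst z)))))) (\<lambda>i. snd z i)}"
    by (intro closed_cert continuous_on_fst continuous_on_snd continuous_on_id)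
  then show ?thesis by (simp only: certc_proj)
qed

text \<open>Tychonoff's theorem, in the topology of pointwise convergence.\<close>

lemma compact_fun_box: "compact {t::nat \<Rightarrow> real. \<forall>i. \<bar>t i\<bar> \<le> M}"
proof -
  have "compactin (product_topology (\<lambda>i::nat. euclidean::real topology) UNIV) (PiE UNIV (\<lambda>_. {-M..M}))"
    by (simp add: compactin_PiE)
  moreover have "PiE UNIV (\<lambda>_. {-M..M}) = {t::nat \<Rightarrow> real. \<forall>i. \<bar>t i\<bar> \<le> M}"
    by (auto simp: PiE_def Pi_def abs_le_iff minus_le_iff)
  ultimately show ?thesis by (simp add: euclidean_product_topology)
qed

text \<open>By \<open>cert_bounded\<close>, the part of the cone in a ball is the projection of a
  compact set of pairs of coefficients and certificates; a convergent sequence stays in such a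
  part.\<close>

lemma closed_cert_cone: "closed cert_cone"
proof -
  have bounded_part: "compact (cert_cone \<inter> cball 0 N)" for N
  proof -
    let ?G = "(cball 0 N \<times> {t. \<forall>i. \<bar>t i\<bar> \<le> 100 * N}) \<inter> {z. certc (fst z) (snd z)}"
    have "compact (fst ` ?G)"
      by (intro compact_continuous_image compact_Int_closed compact_Times compact_cball
          compact_fun_box closed_certc_graph continuous_intros)
    moreover have "fst ` ?G = cert_cone \<inter> cball 0 N"
    proof (intro equalityI subsetI)
      fix k assume k: "k \<in> cert_cone \<inter> cball 0 N"
      obtain p r1 r2 A B C where kk: "k = (p, r1, r2, A, B, C)" by (cases k) auto
      from k kk obtain t where t: "cert p r1 r2 A B C t" by (auto simp: cert_cone_iff)
      define t' where "t' i = (if i \<in> {1..19} then t i else 0)" for i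
      have t': "cert p r1 r2 A B C t'"
        using cert_cong[of t t'] t by (simp add: t'_def)
      have n: "norm k \<le> N" using k by simp
      have "\<bar>p\<bar> \<le> norm k" "norm (snd k) \<le> norm k"
        using norm_fst_le[of p] norm_snd_le[of _ p] unfolding kk by (auto simp del: norm_Pair)
      moreover have "\<bar>r1\<bar> \<le> norm (snd k)" "norm (snd (snd k)) \<le> norm (snd k)"
        using norm_fst_le[of r1] norm_snd_le[of _ r1] unfolding kk by (auto simp del: norm_Pair)
      moreover have "\<bar>r2\<bar> \<le> norm (snd (snd k))" "norm (snd (snd (snd k))) \<le> norm (snd (snd k))"
        using norm_fst_le[of r2] norm_snd_le[of _ r2] unfolding kk by (auto simp del: norm_Pair)
      moreover have "\<bar>A\<bar> \<le> norm (snd (snd (snd k)))"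
          "norm (snd (snd (snd (snd k)))) \<le> norm (snd (snd (snd k)))"
        using norm_fst_le[of A] norm_snd_le[of _ A] unfolding kk by (auto simp del: norm_Pair)
      moreover have "\<bar>B\<bar> \<le> norm (snd (snd (snd (snd k))))" "\<bar>C\<bar> \<le> norm (snd (snd (snd (snd k))))"
        using norm_fst_le[of B C] norm_snd_le[of C B] unfolding kk by (auto simp del: norm_Pair)
      ultimately have b: "\<bar>p\<bar> \<le> N" "\<bar>r1\<bar> \<le> N" "\<bar>r2\<bar> \<le> N" "\<bar>A\<bar> \<le> N" "\<bar>B\<bar> \<le> N" "\<bar>C\<bar> \<le> N"
        using n by linarith+
      have "\<bar>t' i\<bar> \<le> 100 * N" for i
      proof (cases "i \<in> {1..19}")
        case True
        then show ?thesis using cert_bounded[OF t' b] by blast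
      next
        case False
        moreover have "0 \<le> N" using b by linarith
        ultimately show ?thesis by (auto simp: t'_def)
      qed
      moreover have "certc k t'" using t' by (simp add: kk)
      ultimately have "(k, t') \<in> ?G" using k by (intro IntI SigmaI CollectI) (auto simp only: fst_conv snd_conv Int_iff)
      then show "k \<in> fst ` ?G" by (rule rev_image_eqI) simp
    qed (auto simp: cert_cone_iff)
    ultimately show ?thesis by simp
  qed
  show ?thesis
    unfolding closed_sequential_limits
  proof (intro allI impI, elim conjE)
    fix x l assume x: "\<forall>n. x n \<in> cert_cone" "x \<longlonglongrightarrow> l"
    obtain N where N: "\<And>n. norm (x n) \<le> N"
      using convergent_imp_Bseq[OF convergentI[OF x(2)]] by (auto simp: Bseq_def)
    have "x n \<in> cert_cone \<inter> cball 0 N" for n using x(1) N by simp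
    from closed_sequentially[OF compact_imp_closed[OF bounded_part] this x(2)]
    have "l \<in> cert_cone \<inter> cball 0 N" .
    then show "l \<in> cert_cone" by simp
  qed
qed

lemma cert_cone_scale: "0 \<le> a \<Longrightarrow> k \<in> cert_cone \<Longrightarrow> a *\<^sub>R k \<in> cert_cone"
  by (cases k) (auto simp: cert_cone_def certifiable_def intro: cert_scale)

lemma convex_cert_cone: "convex cert_cone"
proof (rule convexI)
  fix k l :: coeffs and a b :: real
  assume "k \<in> cert_cone" "l \<in> cert_cone" "0 \<le> a" "0 \<le> b"
  then have "a *\<^sub>R k \<in> cert_cone" "b *\<^sub>R l \<in> cert_cone" by (simp_all add: cert_cone_scale)
  then show "a *\<^sub>R k + b *\<^sub>R l \<in> cert_cone"
    by (cases "a *\<^sub>R k"; cases "b *\<^sub>R l") (auto simp: cert_cone_def certifiable_def intro: cert_add)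
qed

subsection \<open>Certificates\<close>

lemma nonneg_imp_certifiable:
  assumes q: "\<And>y u. 0 \<le> y \<Longrightarrow> 0 \<le> u \<Longrightarrow> y * u \<le> 1 \<Longrightarrow> 0 \<le> quad p r1 r2 A B C y u"
    and AC: "0 \<le> A" "0 \<le> C"
  shows "certifiable p r1 r2 A B C"
proof (rule ccontr)
  assume "\<not> certifiable p r1 r2 A B C"
  then have "(p, r1, r2, A, B, C) \<notin> cert_cone"
    by (simp add: cert_cone_def)
  from separating_hyperplane_closed_point[OF convex_cert_cone closed_cert_cone this]
  obtain a b where a: "inner a (p, r1, r2, A, B, C) < b" "\<forall>x\<in>cert_cone. b < inner a x"
    by blast
  have zero: "0 \<in> cert_cone"
    using certifiable_square[of 0 0 0] by (simp add: cert_cone_def zero_prod_def)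
  then have "b < 0" using a(2) by force
  \<comment> \<open>A member with a negative value could be rescaled to the value \<open>b\<close>,
    which the separation excludes.\<close>
  have pos: "0 \<le> inner a x" if "x \<in> cert_cone" for x
  proof (rule ccontr)
    assume "\<not> 0 \<le> inner a x"
    then have "inner a ((b / inner a x) *\<^sub>R x) = b" by simp
    moreover have "(b / inner a x) *\<^sub>R x \<in> cert_cone"
      using \<open>b < 0\<close> \<open>\<not> 0 \<le> inner a x\<close> that
      by (intro cert_cone_scale) (auto intro: divide_nonpos_nonpos)
    ultimately show False using a(2) by force
  qed
  obtain m y u yy w uu where aa: "a = (m, y, u, yy, w, uu)" by (cases a) auto
  \<comment> \<open>The halves compensate for the factors 2 in the moment pairing.\<close>
  have "0 \<le> p * m + 2 * r1 * (y / 2) + 2 * r2 * (u / 2) + A * yy + 2 * B * (w / 2) + C * uu"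
  proof (rule dual_nonneg[OF _ q AC])
    fix p r1 r2 A B C assume "certifiable p r1 r2 A B C"
    then have "0 \<le> inner a (p, r1, r2, A, B, C)"
      by (intro pos) (simp add: cert_cone_def)
    then show "0 \<le> p * m + 2 * r1 * (y / 2) + 2 * r2 * (u / 2) + A * yy + 2 * B * (w / 2) + C * uu"
      by (simp add: aa algebra_simps)
  qed
  moreover have "inner a (p, r1, r2, A, B, C) < 0" using a(1) \<open>b < 0\<close> by linarith
  ultimately show False by (simp add: aa algebra_simps)
qed

lemma cert_iff:
  "cert p (r $ 1) (r $ 2) (R $ 1 $ 1) (R $ 1 $ 2) (R $ 2 $ 2) t \<longleftrightarrow>
    pos_semidef (Lam1 R r p t) \<and> pos_semidef (Lam2 t) \<and> pos_semidef (Lam3 t) \<and>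
    pos_semidef (Lam4 t) \<and> pos_semidef (Lam5 t) \<and> pos_semidef (Lam6 t)"
  unfolding cert_def Lam1_def Let_def Lam2_def Lam3_def Lam4_def Lam5_def Lam6_def
    pos_semidef_vector2 pos_semidef_vector3 ..

text \<open>The entries of \<open>Lam1\<close> and the last entries of \<open>Lam3\<close> and
  \<open>Lam5\<close> are built so that every \<open>t i\<close> cancels.\<close>

lemma f_poly_eq:
  "f_poly R r p z1 z2 =
            qform (Lam1 R r p t) (vector [z2, z2^2, z1])
            + z2 * qform (Lam2 t) (vector [z2, z1])
            + z1 * z2 * (1 - z1) * qform (Lam2 t) (vector [0, 1])
            + z1 * z2 * qform (Lam3 t) (vector [1, z2])
            + z1 * qform (Lam4 t) (vector [z2^2, z2, 0])
            + (1 - z1) * qform (Lam4 t) (vector [z2^2, 0, z2])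
            + z2 * qform (Lam5 t) (vector [z2, z1])
            + z1 * qform (Lam6 t) (vector [z1, z2, 0])
            + (1 - z1) * qform (Lam6 t) (vector [z1, 0, z2])"
  unfolding f_poly_def Lam1_def Let_def Lam2_def Lam3_def Lam4_def Lam5_def Lam6_def
    qform_vector2 qform_vector3
  by (simp add: field_simps power2_eq_square power3_eq_cube power4_eq_xxxx)

lemma f_poly_homogenize:
  "f_poly R r p (u * y) y = y^2 * quad p (r $ 1) (r $ 2) (R $ 1 $ 1) (R $ 1 $ 2) (R $ 2 $ 2) y u"
  by (simp add: f_poly_def quad_def algebra_simps power2_eq_square power3_eq_cube power4_eq_xxxx)

lemma quadratic_lead_nonneg:
  fixes a b c :: real
  assumes "\<And>y. 0 < y \<Longrightarrow> 0 \<le> a * y^2 + b * y + c"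
  shows "0 \<le> a"
proof (rule ccontr)
  assume "\<not> 0 \<le> a"
  \<comment> \<open>Here \<open>a * y = a - \<bar>b\<bar> - \<bar>c\<bar>\<close> and
    \<open>y \<ge> 1\<close>, so the quadratic is at most \<open>a * y\<close>.\<close>
  define y where "y = 1 + (\<bar>b\<bar> + \<bar>c\<bar>) / (- a)"
  have y: "1 \<le> y" using \<open>\<not> 0 \<le> a\<close> by (simp add: y_def divide_nonneg_neg)
  have "a * y = a - (\<bar>b\<bar> + \<bar>c\<bar>)" using \<open>\<not> 0 \<le> a\<close> by (simp add: y_def field_simps)
  then have "a * y^2 = (a - (\<bar>b\<bar> + \<bar>c\<bar>)) * y" by (simp add: power2_eq_square)
  moreover have "b * y \<le> \<bar>b\<bar> * y" "c \<le> \<bar>c\<bar> * y" "a * y < 0"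
    using y \<open>\<not> 0 \<le> a\<close> mult_left_mono[of 1 y "\<bar>c\<bar>"]
    by (auto intro: mult_right_mono simp: mult_neg_pos)
  ultimately have "a * y^2 + b * y + c < 0" by (simp add: algebra_simps)
  then show False using assms[of y] y by simp
qed

theorem theorem3p4:
  fixes R :: "real^2^2" and r :: "real^2" and p :: real
  assumes "transpose R = R"
  shows "(\<forall>z1\<in>{0..1}. \<forall>z2\<ge>0. f_poly R r p z1 z2 \<ge> 0) \<longleftrightarrow>
    (\<exists>t :: nat \<Rightarrow> real.
       pos_semidef (Lam1 R r p t) \<and> pos_semidef (Lam2 t) \<and> pos_semidef (Lam3 t) \<and>
       pos_semidef (Lam4 t) \<and> pos_semidef (Lam5 t) \<and> pos_semidef (Lam6 t) \<and>
       (\<forall>z1 z2 :: real.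
          f_poly R r p z1 z2 =
            qform (Lam1 R r p t) (vector [z2, z2^2, z1])
            + z2 * qform (Lam2 t) (vector [z2, z1])
            + z1 * z2 * (1 - z1) * qform (Lam2 t) (vector [0, 1])
            + z1 * z2 * qform (Lam3 t) (vector [1, z2])
            + z1 * qform (Lam4 t) (vector [z2^2, z2, 0])
            + (1 - z1) * qform (Lam4 t) (vector [z2^2, 0, z2])
            + z2 * qform (Lam5 t) (vector [z2, z1])
            + z1 * qform (Lam6 t) (vector [z1, z2, 0])
            + (1 - z1) * qform (Lam6 t) (vector [z1, 0, z2])))"
    (is "?nonneg \<longleftrightarrow> ?certificate")
proof
  assume f: ?nonneg
  let ?q = "quad p (r $ 1) (r $ 2) (R $ 1 $ 1) (R $ 1 $ 2) (R $ 2 $ 2)"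
  have interior: "0 \<le> ?q y u" if "0 < y" "0 \<le> u" "y * u \<le> 1" for y u
  proof -
    have "0 \<le> f_poly R r p (u * y) y" using f that by (simp add: mult.commute)
    then show ?thesis using that by (simp add: f_poly_homogenize zero_le_mult_iff)
  qed
  have q: "0 \<le> ?q y u" if "0 \<le> y" "0 \<le> u" "y * u \<le> 1" for y u
  proof (cases "y = 0")
    case True
    \<comment> \<open>The substitution \<open>u = z1 / z2\<close> misses the edge
      \<open>y = 0\<close>, which is reached by a limit; \<open>y < 1 / (u + 1)\<close> keeps
      \<open>y * u \<le> 1\<close>.\<close>
    have "((\<lambda>y. ?q y u) \<longlongrightarrow> ?q 0 u) (at_right 0)"
      unfolding quad_def by (intro tendsto_intros)
    moreover have "\<forall>\<^sub>F y in at_right 0. 0 \<le> ?q y u"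
    proof -
      have "\<forall>\<^sub>F y in at_right 0. y \<in> {0<..<1 / (u + 1)}"
        using that by (intro eventually_at_right_real) simp
      then show ?thesis
      proof eventually_elim
        case (elim y)
        have "y * u \<le> y * (u + 1)" using elim by (simp add: algebra_simps)
        also have "\<dots> \<le> 1" using elim that by (simp add: less_divide_eq)
        finally show ?case using interior[of y u] elim that by simp
      qed
    qed
    ultimately have "0 \<le> ?q 0 u" by (rule tendsto_lowerbound) simp
    then show ?thesis using True by simp
  qed (use interior that in simp)
  \<comment> \<open>Both coordinate axes lie in the region, so the form's leading coefficients along
    them are nonnegative.\<close>
  have "0 \<le> R $ 1 $ 1"
    by (rule quadratic_lead_nonneg[of _ "2 * r $ 1" p]) (use q[of _ 0] in \<open>simp add: quad_def algebra_simps\<close>)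
  moreover have "0 \<le> R $ 2 $ 2"
    by (rule quadratic_lead_nonneg[of _ "2 * r $ 2" p]) (use q[of 0] in \<open>simp add: quad_def algebra_simps\<close>)
  ultimately have "certifiable p (r $ 1) (r $ 2) (R $ 1 $ 1) (R $ 1 $ 2) (R $ 2 $ 2)"
    by (intro nonneg_imp_certifiable q)
  then show ?certificate
    unfolding certifiable_def cert_iff using f_poly_eq by blast
next
  assume ?certificate
  then obtain t where t: "pos_semidef (Lam1 R r p t)" "pos_semidef (Lam2 t)" "pos_semidef (Lam3 t)"
    "pos_semidef (Lam4 t)" "pos_semidef (Lam5 t)" "pos_semidef (Lam6 t)"
    by blast
  then show ?nonneg
    unfolding f_poly_eq[where t = t] pos_semidef_def
    by (auto intro!: add_nonneg_nonneg mult_nonneg_nonneg)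
qed

end
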